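(* Let $r>0$ be real and $q=e^{-\pi\sqrt r}$. Then $$S(q)=\frac{(k_r)^{1/4}}{\sqrt2}.$$
   Context: $K(x)=\int_0^{\pi/2}\frac{dt}{\sqrt{1-x^2\sin^2 t}}$ for $0\le x<1$. For real $r>0$, $k_r\in(0,1)$ is the unique solution $k$ of $K(\sqrt{1-k^2})/K(k)=\sqrt r$. For $0<q<1$ the continued fraction $S$ is $$S(q)=q^{1/8}\cfrac{1}{1+\cfrac{q}{1+\cfrac{q^2+q}{1+\cfrac{q^3}{1+\cfrac{q^4+q^2}{1+\cfrac{q^5}{1+\cdots}}}}}},$$ the partial numerators after the initial $1$ being alternately $q^{2n-1}$ and $q^{2n}+q^n$ ($n=1,2,\dots$), all partial denominators being $1$. Roots are the positive real ones. *)

theory Defs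
  imports "HOL-Analysis.Analysis"
begin

definition ellK :: "real \<Rightarrow> real" where
  "ellK x = integral {0..pi/2} (\<lambda>t. 1 / sqrt (1 - x\<^sup>2 * (sin t)\<^sup>2))"

definition singular_modulus :: "real \<Rightarrow> real" where
  "singular_modulus r =
     (THE k. 0 < k \<and> k < 1 \<and> ellK (sqrt (1 - k\<^sup>2)) / ellK k = sqrt r)"

(* cf_approximant n a = a 0 / (1 + a 1 / (1 + ... + a (n-1) / 1)),
   the n-th approximant of the continued fraction with partial numerators a 0, a 1, ...
   and all partial denominators equal to 1. *)
fun cf_approximant :: "nat \<Rightarrow> (nat \<Rightarrow> real) \<Rightarrow> real" where
  "cf_approximant 0 a = 0"
| "cf_approximant (Suc n) a = a 0 / (1 + cf_approximant n (\<lambda>i. a (Suc i)))"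

(* Partial numerators 1, q, q^2 + q, q^3, q^4 + q^2, q^5, ...: for n = 1, 2, ... the entry
   at index 2n - 1 is q^(2n-1) and the entry at index 2n is q^(2n) + q^n. *)
definition S_numerator :: "real \<Rightarrow> nat \<Rightarrow> real" where
  "S_numerator q i =
     (if i = 0 then 1 else if odd i then q ^ i else q ^ i + q ^ (i div 2))"

definition S_approximant :: "real \<Rightarrow> nat \<Rightarrow> real" where
  "S_approximant q n = q powr (1/8) * cf_approximant n (S_numerator q)"

(* Meaningful only where the approximants converge, since lim is total. *)
definition S_cf :: "real \<Rightarrow> real" where
  "S_cf q = lim (S_approximant q)"

end

theory Submission
  imports Defs
begin

text \<open>
  The series \<open>Y(m, e) = \<Sum> q^(n (n + e)) / ((q)\<^sub>n (-q)\<^sub>n\<^sub>+\<^sub>m)\<close> satisfy two contiguous relations which make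
  \<open>Y(\<lfloor>j / 2\<rfloor>, j)\<close> a solution of the three-term recurrence of the continued fraction. Since the partial
  numerators decay geometrically, the approximants converge to \<open>u = Y(0, 1) / Y(0, 0)\<close>. Multiplying out
  \<open>Y(0, 0)\<^sup>2\<close> and \<open>Y(0, 1)\<^sup>2\<close> along the diagonals of the lattice gives, by Durfee's identity, the theta
  series \<open>\<Sum> q^(k\<^sup>2)\<close> and \<open>\<Sum> q^(k (k + 1))\<close> over the integers up to constant factors. Hence
  \<open>k(q) = 4 sqrt q u^4\<close> is the theta modulus \<open>\<theta>\<^sub>2\<^sup>2 / \<theta>\<^sub>3\<^sup>2\<close>, and the duplication formulas of the theta
  series say that \<open>k(q)\<close> and \<open>k(q\<^sup>2)\<close> are related by the Landen transformation, under which \<open>K'/K\<close>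
  doubles. Iterating, and using \<open>K'(k) = - ln k + O(1)\<close> as \<open>k\<close> tends to \<open>0\<close>, yields
  \<open>K'/K = - ln q / \<pi>\<close> at \<open>k(q)\<close>. As \<open>K'/K\<close> is strictly decreasing, \<open>k(q)\<close> is the singular modulus.
\<close>

subsection \<open>Continued fractions with vanishing partial numerators\<close>

text \<open>The ratio bound \<open>C * q ^ n\<close> tends to 0, so it is eventually below 1/2
  whatever the size of \<open>C\<close>. It serves both the products of partial numerators and the
  q-series.\<close>

lemma summable_geometric_ratio:
  fixes f :: "nat \<Rightarrow> real"
  assumes q: "0 < q" "q < 1" and pos: "\<And>n. 0 \<le> f n"
    and ratio: "\<And>n. f (Suc n) \<le> C * q ^ n * f n"
  shows "summable f"
proof -
  have "(\<lambda>n. C * q ^ n) \<longlonglongrightarrow> C * 0"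
    by (intro tendsto_intros LIMSEQ_power_zero) (use q in auto)
  then have "eventually (\<lambda>n. C * q ^ n < 1 / 2) sequentially"
    by (intro order_tendstoD) auto
  then obtain N where N: "\<And>n. n \<ge> N \<Longrightarrow> C * q ^ n < 1 / 2"
    by (auto simp: eventually_sequentially)
  show ?thesis
  proof (rule summable_ratio_test[of "1/2" N])
    fix n assume "n \<ge> N"
    then have "C * q ^ n * f n \<le> 1 / 2 * f n"
      using N[of n] pos[of n] by (intro mult_right_mono) auto
    with ratio[of n] show "norm (f (Suc n)) \<le> 1 / 2 * norm (f n)"
      using pos by simp
  qed simp
qed

lemma cf_approximant_nonneg:
  assumes "\<And>i. 0 \<le> a i"
  shows "0 \<le> cf_approximant n a"
  using assms by (induction n arbitrary: a) auto

text \<open>\<open>T i\<close> stands for the tail 1 / (1 + a (i+1) / (1 + ...)). All denominators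
  are at least 1, so each level of the fraction multiplies a discrepancy by at most its partial
  numerator; truncation at depth 0 costs at most \<open>a 0\<close>.\<close>

lemma cf_approximant_error:
  assumes a: "\<And>i. 0 \<le> a i" and T: "\<And>i. 0 \<le> T i" "\<And>i. T i \<le> 1"
    and rec: "\<And>i. T i * (1 + a (Suc i) * T (Suc i)) = 1"
  shows "\<bar>cf_approximant n a - a 0 * T 0\<bar> \<le> (\<Prod>i\<le>n. a i)"
  using assms
proof (induction n arbitrary: a T)
  case 0
  then show ?case using mult_left_mono[of "T 0" 1 "a 0"] by simp
next
  case (Suc n)
  let ?x = "cf_approximant n (\<lambda>i. a (Suc i))" and ?y = "a (Suc 0) * T (Suc 0)"
  have IH: "\<bar>?x - ?y\<bar> \<le> (\<Prod>i\<le>n. a (Suc i))"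
    using Suc.IH[of "\<lambda>i. a (Suc i)" "\<lambda>i. T (Suc i)"] Suc.prems by simp
  have x: "0 \<le> ?x" using Suc.prems by (intro cf_approximant_nonneg)
  have y: "0 \<le> ?y" using Suc.prems by simp
  have T0: "T 0 = 1 / (1 + ?y)"
    using Suc.prems(4)[of 0] y by (simp add: field_simps)
  have "a 0 / (1 + ?x) - a 0 / (1 + ?y) = a 0 * ((?y - ?x) / ((1 + ?x) * (1 + ?y)))"
    using x y by (simp add: divide_simps add_pos_nonneg) (simp add: algebra_simps)
  then have "\<bar>a 0 / (1 + ?x) - a 0 / (1 + ?y)\<bar> = a 0 * (\<bar>?x - ?y\<bar> / ((1 + ?x) * (1 + ?y)))"
    using x y Suc.prems(1)[of 0] by (simp add: abs_mult abs_minus_commute)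
  also have "\<dots> \<le> a 0 * (\<bar>?x - ?y\<bar> / 1)"
    using x y Suc.prems(1)[of 0]
    by (intro mult_left_mono divide_left_mono) (auto intro!: mult_ge1_I simp: add_pos_nonneg)
  also have "\<dots> \<le> a 0 * (\<Prod>i\<le>n. a (Suc i))"
    using IH Suc.prems(1)[of 0] by (intro mult_left_mono) auto
  also have "\<dots> = (\<Prod>i\<le>Suc n. a i)"
    by (simp only: prod.atMost_Suc_shift)
  finally show ?case using T0 by simp
qed

text \<open>The geometric bound on the partial numerators sends the error product to 0, which gives
  convergence as well as the value.\<close>

lemma cf_approximant_tendsto:
  assumes a: "\<And>i. 0 \<le> a i" and T: "\<And>i. 0 \<le> T i" "\<And>i. T i \<le> 1"
    and rec: "\<And>i. T i * (1 + a (Suc i) * T (Suc i)) = 1"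
    and q: "0 < q" "q < 1" and bound: "\<And>i. a (Suc i) \<le> C * q ^ i"
  shows "(\<lambda>n. cf_approximant n a) \<longlonglongrightarrow> a 0 * T 0"
proof -
  have "summable (\<lambda>n. \<Prod>i\<le>n. a i)"
  proof (rule summable_geometric_ratio[OF q])
    show "0 \<le> (\<Prod>i\<le>n. a i)" for n using a by (intro prod_nonneg) auto
    show "(\<Prod>i\<le>Suc n. a i) \<le> C * q ^ n * (\<Prod>i\<le>n. a i)" for n
      using mult_right_mono[OF bound[of n], of "\<Prod>i\<le>n. a i"] a
      by (simp add: prod_nonneg mult.commute)
  qed
  then have "(\<lambda>n. \<Prod>i\<le>n. a i) \<longlonglongrightarrow> 0"
    by (rule summable_LIMSEQ_zero)
  then have "(\<lambda>n. cf_approximant n a - a 0 * T 0) \<longlonglongrightarrow> 0"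
    by (rule Lim_null_comparison[rotated])
       (use cf_approximant_error[of a T] a T rec in auto)
  then show ?thesis by (rule LIM_zero_cancel)
qed

subsection \<open>A family of basic hypergeometric series\<close>

text \<open>The q-Pochhammer symbol (a; q)_n.\<close>

definition qpoch :: "real \<Rightarrow> real \<Rightarrow> nat \<Rightarrow> real" where
  "qpoch a q n = (\<Prod>i<n. 1 - a * q ^ i)"

lemma qpoch_0 [simp]: "qpoch a q 0 = 1"
  and qpoch_Suc: "qpoch a q (Suc n) = qpoch a q n * (1 - a * q ^ n)"
  by (simp_all add: qpoch_def)

lemma qpoch_factor_pos:
  fixes q b :: real
  assumes "0 < q" "q < 1" "\<bar>b\<bar> \<le> 1"
  shows "1 - q \<le> 1 - b * q * q ^ n" "0 < 1 - b * q * q ^ n"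
proof -
  have "b * (q * q ^ n) \<le> 1 * (q * q ^ n)"
    using assms by (intro mult_right_mono) auto
  also have "\<dots> \<le> q"
    using assms by (simp add: mult_le_cancel_left1 power_le_one)
  finally have "b * (q * q ^ n) \<le> q" .
  then show "1 - q \<le> 1 - b * q * q ^ n" by (simp add: mult.assoc)
  with assms show "0 < 1 - b * q * q ^ n" by linarith
qed

lemma qpoch_pos:
  assumes "0 < q" "q < 1" "\<bar>b\<bar> \<le> 1"
  shows "0 < qpoch (b * q) q n"
  unfolding qpoch_def using qpoch_factor_pos[OF assms] by (intro prod_pos) auto

text \<open>The case \<open>b = -1\<close> gives the series Y of the continued fraction, the case
  \<open>b = 1\<close> the Durfee series; the parameter lets the same contiguous relations serve
  both.\<close>

definition qser_term :: "real \<Rightarrow> real \<Rightarrow> nat \<Rightarrow> nat \<Rightarrow> nat \<Rightarrow> real" where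
  "qser_term q b m e n = q ^ (n * (n + e)) / (qpoch q q n * qpoch (b * q) q (n + m))"

definition qser :: "real \<Rightarrow> real \<Rightarrow> nat \<Rightarrow> nat \<Rightarrow> real" where
  "qser q b m e = (\<Sum>n. qser_term q b m e n)"

context
  fixes q b :: real
  assumes q: "0 < q" "q < 1" and b: "\<bar>b\<bar> \<le> 1"
begin

lemma qser_term_pos: "0 < qser_term q b m e n"
  using q qpoch_pos[OF q b] qpoch_pos[OF q, of 1] by (simp add: qser_term_def)

text \<open>Reindexing: (n+1)(n+1+e) = (e+1) + n(n+e+2), and \<open>1 - q * q ^ n\<close> cancels
  the last factor of \<open>qpoch q q (Suc n)\<close>.\<close>

lemma qser_term_Suc:
  "qser_term q b m e (Suc n) * (1 - q * q ^ n) = q ^ (e + 1) * qser_term q b (m + 1) (e + 2) n"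
proof -
  have "0 < 1 - q * q ^ n" using qpoch_factor_pos[OF q, of 1 n] by simp
  moreover have "q ^ (Suc n * (Suc n + e)) = q ^ (e + 1) * q ^ (n * (n + (e + 2)))"
    by (simp add: power_add[symmetric] algebra_simps)
  ultimately show ?thesis
    by (simp add: qser_term_def qpoch_Suc)
qed

lemma summable_qser_term: "summable (qser_term q b m e)"
proof (rule summable_geometric_ratio[OF q, where C = "1 / (1 - q)\<^sup>2"])
  fix n
  show "0 \<le> qser_term q b m e n" using qser_term_pos less_imp_le by blast
  \<comment> \<open>Each of the two denominator factors gained from n to n + 1 is at least 1 - q;
    hence the constant \<open>1 / (1 - q)\<^sup>2\<close>.\<close>
  have f: "1 - q \<le> 1 - q * q ^ n" "1 - q \<le> 1 - b * q * q ^ (n + m)"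
    using qpoch_factor_pos[OF q, of 1 n] qpoch_factor_pos[OF q b, of "n + m"] by auto
  have "Suc n * (Suc n + e) = (2 * n + e + 1) + n * (n + e)"
    by (simp add: algebra_simps)
  then have "q ^ (Suc n * (Suc n + e)) = q ^ (2 * n + e + 1) * q ^ (n * (n + e))"
    by (simp only: power_add)
  then have "qser_term q b m e (Suc n) =
      q ^ (2 * n + e + 1) / ((1 - q * q ^ n) * (1 - b * q * q ^ (n + m))) * qser_term q b m e n"
    by (simp only: qser_term_def qpoch_Suc add_Suc times_divide_times_eq mult_ac)
  also have "\<dots> \<le> q ^ n / ((1 - q) * (1 - q)) * qser_term q b m e n"
  proof (intro mult_right_mono frac_le mult_mono)
    show "q ^ (2 * n + e + 1) \<le> q ^ n" using q by (intro power_decreasing) auto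
  qed (use f q qser_term_pos[of m e n] in \<open>auto simp: less_imp_le mult_le_one\<close>)
  finally show "qser_term q b m e (Suc n) \<le> 1 / (1 - q)\<^sup>2 * q ^ n * qser_term q b m e n"
    by (simp add: power2_eq_square)
qed

lemma qser_sums: "qser_term q b m e sums qser q b m e"
  unfolding qser_def using summable_qser_term by (rule summable_sums)

lemma qser_pos: "0 < qser q b m e"
  unfolding qser_def using summable_qser_term qser_term_pos by (rule suminf_pos)

text \<open>Raising e by 1 multiplies the n-th term by q^n. The difference of the two series thus
  carries the factor 1 - q^n, which kills the term n = 0 and cancels the last factor of (q; q)_n in
  the others; an index shift finishes.\<close>

lemma qser_step_exponent:
  "qser q b m e = qser q b m (e + 1) + q ^ (e + 1) * qser q b (m + 1) (e + 2)"
proof -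
  let ?d = "\<lambda>n. qser_term q b m e n * (1 - q ^ n)"
  have d: "?d n = qser_term q b m e n - qser_term q b m (e + 1) n" for n
  proof -
    have "q ^ (n * (n + (e + 1))) = q ^ (n * (n + e)) * q ^ n"
      by (simp add: power_add[symmetric] algebra_simps)
    then show ?thesis by (simp add: qser_term_def diff_divide_distrib algebra_simps)
  qed
  have 1: "?d sums (qser q b m e - qser q b m (e + 1))"
    unfolding d by (intro sums_diff qser_sums)
  have "(\<lambda>n. ?d (Suc n)) sums (q ^ (e + 1) * qser q b (m + 1) (e + 2))"
    using sums_mult[OF qser_sums] qser_term_Suc by simp
  then have "?d sums (q ^ (e + 1) * qser q b (m + 1) (e + 2))"
    by (subst (asm) sums_Suc_iff) simp
  from sums_unique2[OF 1 this] show ?thesis by simp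
qed

text \<open>This holds termwise: the n-th fraction is expanded by the missing factor 1 - b
  q^(n+m+1), and the q^n in its second part raises e by 1.\<close>

lemma qser_step_shift:
  "qser q b m e = qser q b (m + 1) e - b * q ^ (m + 1) * qser q b (m + 1) (e + 1)"
proof -
  have *: "qser_term q b m e n =
      qser_term q b (m + 1) e n - b * q ^ (m + 1) * qser_term q b (m + 1) (e + 1) n" for n
  proof -
    have "q ^ (n * (n + (e + 1))) = q ^ (n * (n + e)) * q ^ n"
      by (simp add: power_add[symmetric] algebra_simps)
    moreover have "0 < 1 - b * q * q ^ (n + m)" by (rule qpoch_factor_pos[OF q b])
    moreover have "0 < qpoch q q n" "0 < qpoch (b * q) q (n + m)"
      using qpoch_pos[OF q b] qpoch_pos[OF q, of 1] by simp_all
    ultimately show ?thesis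
      by (simp add: qser_term_def qpoch_Suc divide_simps) (simp add: power_add algebra_simps)
  qed
  have "qser_term q b m e sums
      (qser q b (m + 1) e - b * q ^ (m + 1) * qser q b (m + 1) (e + 1))"
    by (subst sums_cong[OF *]) (intro sums_diff sums_mult qser_sums)
  then show ?thesis using qser_sums sums_unique2 by blast
qed

lemma qser_antimono: "qser q b m (e + 1) \<le> qser q b m e"
  using qser_step_exponent[of m e] qser_pos[of "m + 1" "e + 2"] q by simp

end

text \<open>Durfee's identity without its common value \<open>1 / (q)\<^sub>\<infinity>\<close>, which cancels in theta quotients.\<close>

lemma qser_diagonal:
  assumes q: "0 < q" "q < 1"
  shows "qser q 1 k k = qser q 1 0 0"
proof (induction k)
  case (Suc k)
  \<comment> \<open>For \<open>b = 1\<close> the two relations contain q^(k+1) Y(k+1, k+2) with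
    opposite signs, so a step along the diagonal changes nothing.\<close>
  then show ?case
    using qser_step_exponent[OF q, of 1 k k] qser_step_shift[OF q, of 1 k "k + 1"] by simp
qed simp

subsection \<open>The value of the continued fraction\<close>

definition cf_series :: "real \<Rightarrow> nat \<Rightarrow> real" where
  "cf_series q j = qser q (-1) (j div 2) j"

definition cf_value :: "real \<Rightarrow> real" where
  "cf_value q = qser q (-1) 0 1 / qser q (-1) 0 0"

context
  fixes q :: real
  assumes q: "0 < q" "q < 1"
begin

lemma cf_series_pos: "0 < cf_series q j"
  unfolding cf_series_def by (rule qser_pos[OF q]) simp

text \<open>For even \<open>j\<close> this is the exponent relation as it stands. For odd
  \<open>j\<close> the exponent and shift relations are each used twice, and their combination
  produces the two-term numerator q^(2m+2) + q^(m+1).\<close>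

lemma cf_series_rec:
  "cf_series q j = cf_series q (j + 1) + S_numerator q (j + 1) * cf_series q (j + 2)"
proof (cases "even j")
  case True
  then obtain m where "j = 2 * m" by blast
  then show ?thesis
    using qser_step_exponent[OF q, of "-1" m "2 * m"] by (simp add: cf_series_def S_numerator_def)
next
  case False
  then obtain m where j: "j = 2 * m + 1" by (auto elim: oddE)
  let ?Y = "qser q (-1)"
  note e = qser_step_exponent[OF q, of "-1"] and s = qser_step_shift[OF q, of "-1"]
  have e1: "?Y (m + 1) (2 * m + 1) = ?Y (m + 1) (2 * m + 2) + q ^ (2 * m + 2) * ?Y (m + 2) (2 * m + 3)"
    using e[of "m + 1" "2 * m + 1"] by (simp add: numeral_eq_Suc)
  have e2: "?Y (m + 1) (2 * m + 2) = ?Y (m + 1) (2 * m + 3) + q ^ (2 * m + 3) * ?Y (m + 2) (2 * m + 4)"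
    using e[of "m + 1" "2 * m + 2"] by (simp add: numeral_eq_Suc)
  have s1: "?Y m (2 * m + 1) = ?Y (m + 1) (2 * m + 1) + q ^ (m + 1) * ?Y (m + 1) (2 * m + 2)"
    using s[of m "2 * m + 1"] by (simp add: numeral_eq_Suc)
  have s2: "?Y (m + 1) (2 * m + 3) = ?Y (m + 2) (2 * m + 3) + q ^ (m + 2) * ?Y (m + 2) (2 * m + 4)"
    using s[of "m + 1" "2 * m + 3"] by (simp add: numeral_eq_Suc)
  \<comment> \<open>Both products equal q^(3m+4); hence the terms with Y(m+2, 2m+4) cancel.\<close>
  have pw: "q ^ (m + 1) * q ^ (2 * m + 3) = q ^ (2 * m + 2) * q ^ (m + 2)"
    by (simp only: power_add[symmetric]) (rule arg_cong[where f = "power q"], simp)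
  have "q ^ (m + 1) * ?Y (m + 1) (2 * m + 2) + q ^ (2 * m + 2) * ?Y (m + 2) (2 * m + 3)
      = q ^ (m + 1) * ?Y (m + 1) (2 * m + 3) + (q ^ (m + 1) * q ^ (2 * m + 3)) * ?Y (m + 2) (2 * m + 4)
        + q ^ (2 * m + 2) * (?Y (m + 1) (2 * m + 3) - q ^ (m + 2) * ?Y (m + 2) (2 * m + 4))"
    unfolding e2 s2 by (simp add: algebra_simps)
  also have "\<dots> = (q ^ (m + 1) + q ^ (2 * m + 2)) * ?Y (m + 1) (2 * m + 3)"
    unfolding pw by (simp add: algebra_simps)
  finally have "?Y m (2 * m + 1) = ?Y (m + 1) (2 * m + 2)
      + (q ^ (2 * m + 2) + q ^ (m + 1)) * ?Y (m + 1) (2 * m + 3)"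
    using e1 s1 by (simp add: algebra_simps)
  moreover have "(j + 1) div 2 = m + 1" "(j + 2) div 2 = m + 1" "j div 2 = m"
    "j + 1 = 2 * m + 2" "j + 2 = 2 * m + 3" "even (j + 1)"
    using j by simp_all
  ultimately show ?thesis
    using j by (simp add: cf_series_def S_numerator_def numeral_3_eq_3)
qed

lemma S_numerator_nonneg: "0 \<le> S_numerator q i"
  using q by (simp add: S_numerator_def)

text \<open>The entry at index 2n contains q^n, so the decay is that of powers of
  \<open>sqrt q\<close> rather than of \<open>q\<close>; the 2 counts the summands.\<close>

lemma S_numerator_le: "S_numerator q (Suc i) \<le> 2 / sqrt q * sqrt q ^ i"
proof -
  have "q ^ k \<le> sqrt q ^ i / sqrt q" if "i \<le> 2 * k + 1" for k
  proof -
    have "q ^ k * sqrt q = sqrt q ^ (2 * k + 1)" using q by (simp add: power_mult)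
    also have "\<dots> \<le> sqrt q ^ i" using q that by (intro power_decreasing) auto
    finally show ?thesis using q by (simp add: field_simps)
  qed
  from this[of "Suc i"] this[of "Suc i div 2"]
  have "q ^ Suc i \<le> sqrt q ^ i / sqrt q" "q ^ (Suc i div 2) \<le> sqrt q ^ i / sqrt q"
    by (simp_all del: power_Suc)
  moreover have "0 \<le> q ^ (Suc i div 2)" using q by simp
  moreover have "S_numerator q (Suc i) \<le> q ^ Suc i + q ^ (Suc i div 2)"
    using q by (simp add: S_numerator_def)
  ultimately have "S_numerator q (Suc i) \<le> 2 * (sqrt q ^ i / sqrt q)"
    by linarith
  then show ?thesis by simp
qed

lemma S_approximant_tendsto: "S_approximant q \<longlonglongrightarrow> q powr (1/8) * cf_value q"
proof -
  \<comment> \<open>The tails are quotients of consecutive solutions: dividing the three-term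
    recurrence by \<open>cf_series q i\<close> gives the tail equation.\<close>
  let ?T = "\<lambda>i. cf_series q (Suc i) / cf_series q i"
  have "(\<lambda>n. cf_approximant n (S_numerator q)) \<longlonglongrightarrow> S_numerator q 0 * ?T 0"
  proof (rule cf_approximant_tendsto[where q = "sqrt q", OF S_numerator_nonneg])
    fix i
    show "0 \<le> ?T i" using cf_series_pos by (simp add: less_imp_le)
    have "0 \<le> S_numerator q (i + 1) * cf_series q (i + 2)"
      using S_numerator_nonneg cf_series_pos[of "i + 2"] by simp
    with cf_series_rec[of i] cf_series_pos[of i] show "?T i \<le> 1" by simp
    have "?T i * (1 + S_numerator q (Suc i) * ?T (Suc i)) =
        (cf_series q (Suc i) + S_numerator q (Suc i) * cf_series q (Suc (Suc i))) / cf_series q i"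
      using cf_series_pos[of i] cf_series_pos[of "Suc i"] by (simp add: field_simps)
    also have "cf_series q (Suc i) + S_numerator q (Suc i) * cf_series q (Suc (Suc i)) = cf_series q i"
      using cf_series_rec[of i] by simp
    also have "cf_series q i / cf_series q i = 1"
      using cf_series_pos[of i] by simp
    finally show "?T i * (1 + S_numerator q (Suc i) * ?T (Suc i)) = 1" .
    show "S_numerator q (Suc i) \<le> 2 / sqrt q * sqrt q ^ i" by (rule S_numerator_le)
  qed (use q in auto)
  also have "S_numerator q 0 * ?T 0 = cf_value q"
    by (simp add: S_numerator_def cf_series_def cf_value_def)
  finally show ?thesis unfolding S_approximant_def by (rule tendsto_mult_left)
qed

text \<open>These bounds keep \<open>ln (cf_value q)\<close> bounded along the iterated squares of
  the nome. The lower one combines Y(0,0) = Y(0,1) + q Y(1,2) with Y(1,2) \<le> Y(0,1).\<close>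

lemma cf_value_bounds: "1 / (1 + q) \<le> cf_value q" "cf_value q \<le> 1"
proof -
  let ?Y = "qser q (-1)"
  have pos: "0 < ?Y 0 0" "0 < ?Y 0 1" by (rule qser_pos[OF q]; simp)+
  have "?Y 0 1 \<le> ?Y 0 0" using qser_antimono[OF q, of "-1" 0 0] by simp
  then show "cf_value q \<le> 1" using pos by (simp add: cf_value_def)
  have "?Y 0 1 = ?Y 1 1 + q * ?Y 1 2"
    using qser_step_shift[OF q, of "-1" 0 1] by (simp add: numeral_eq_Suc)
  moreover have "0 < q * ?Y 1 2" using q by (intro mult_pos_pos qser_pos) auto
  moreover have "?Y 1 2 \<le> ?Y 1 1"
    using qser_antimono[OF q, of "-1" 1 1] by (simp add: numeral_eq_Suc)
  ultimately have "?Y 1 2 \<le> ?Y 0 1" by linarith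
  then have "q * ?Y 1 2 \<le> q * ?Y 0 1" using q by simp
  moreover have "?Y 0 0 = ?Y 0 1 + q * ?Y 1 2"
    using qser_step_exponent[OF q, of "-1" 0 0] by (simp add: numeral_eq_Suc)
  ultimately have "?Y 0 0 \<le> ?Y 0 1 * (1 + q)" by (simp add: distrib_left mult.commute[of q])
  then show "1 / (1 + q) \<le> cf_value q"
    using pos q by (simp add: cf_value_def divide_simps mult.commute)
qed

end

subsection \<open>Theta series\<close>

lemma has_sum_times:
  fixes f :: "'a \<Rightarrow> real" and g :: "'b \<Rightarrow> real"
  assumes f: "(f has_sum a) A" and g: "(g has_sum b) B"
    and pos: "\<And>x. x \<in> A \<Longrightarrow> 0 \<le> f x" "\<And>y. y \<in> B \<Longrightarrow> 0 \<le> g y"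
  shows "((\<lambda>(x, y). f x * g y) has_sum (a * b)) (A \<times> B)"
proof (rule has_sum_SigmaI)
  show "((\<lambda>y. case (x, y) of (x, y) \<Rightarrow> f x * g y) has_sum (f x * b)) B" if "x \<in> A" for x
    using has_sum_cmult_right[OF g, of "f x"] by simp
  show fb: "((\<lambda>x. f x * b) has_sum (a * b)) A"
    by (rule has_sum_cmult_left[OF f])
  show "(\<lambda>(x, y). f x * g y) summable_on A \<times> B"
    by (rule summable_on_SigmaI[where g = "\<lambda>x. f x * b"])
       (use has_sum_cmult_right[OF g] fb pos in \<open>auto simp: summable_on_def\<close>)
qed

text \<open>In Jacobi's notation \<open>theta q 0 = \<theta>\<^sub>3\<close> and \<open>q powr (1/4) * theta q 1 = \<theta>\<^sub>2\<close>.\<close>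

definition theta :: "real \<Rightarrow> int \<Rightarrow> real" where
  "theta q c = (\<Sum>\<^sub>\<infinity>k. q powi (k * (k + c)))"

text \<open>Factorwise (1 - x)(1 + x) = 1 - x^2. For \<open>b = -1\<close> and m = 0 the
  denominators thus collapse to base q^2.\<close>

lemma qpoch_square: "qpoch q q n * qpoch (- q) q n = qpoch (q\<^sup>2) (q\<^sup>2) n"
  by (induction n) (simp_all add: qpoch_Suc algebra_simps power2_eq_square power_mult_distrib)

lemma qser_term_minus_one: "qser_term q (-1) 0 c n = q ^ (n * (n + c)) / qpoch (q\<^sup>2) (q\<^sup>2) n"
  by (simp add: qser_term_def qpoch_square)

context
  fixes q :: real
  assumes q: "0 < q" "q < 1"
begin

lemma q_square: "0 < q\<^sup>2" "q\<^sup>2 < 1"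
  using q by (auto simp: power_less_one_iff)

lemma qpoch_square_pos: "0 < qpoch (q\<^sup>2) (q\<^sup>2) n"
  using qpoch_pos[OF q_square, of 1] by simp

lemma qser_has_sum:
  "((\<lambda>n. q ^ (n * (n + c)) / qpoch (q\<^sup>2) (q\<^sup>2) n) has_sum qser q (-1) 0 c) UNIV"
  using qser_sums[OF q, of "-1" 0 c] qpoch_square_pos q
  by (intro sums_nonneg_imp_has_sum) (auto simp: qser_term_minus_one[abs_def] less_imp_le)

text \<open>The companion series with -c in place of c; \<open>real c + 1\<close> encodes 1 for c =
  0 and 2 for c = 1. For c = 1 the term at n + 1 splits into two consecutive terms of the series for
  +1, so that series is counted twice. The truncation in \<open>n - c\<close> occurs only at n = 0,
  where the factor n vanishes.\<close>

lemma qser_has_sum_minus: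
  assumes "c \<le> 1"
  shows "((\<lambda>n. q ^ (n * (n - c)) / qpoch (q\<^sup>2) (q\<^sup>2) n) has_sum ((real c + 1) * qser q (-1) 0 c)) UNIV"
proof (cases "c = 0")
  case True
  then show ?thesis using qser_has_sum[of 0] by simp
next
  case False
  with assms have c: "c = 1" by simp
  let ?P = "qpoch (q\<^sup>2) (q\<^sup>2)"
  let ?h = "\<lambda>n. q ^ (n * (n - 1)) / ?P n" and ?t = "\<lambda>n. q ^ (n * (n + 1)) / ?P n"
  have t: "?t sums qser q (-1) 0 1"
    using qser_sums[OF q, of "-1" 0 1] by (simp add: qser_term_minus_one[abs_def])
  have "?h (Suc n) = ?t (Suc n) + ?t n" for n
  proof -
    have "?P (Suc n) = ?P n * (1 - q\<^sup>2 * (q\<^sup>2) ^ n)" by (rule qpoch_Suc)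
    moreover from this have "0 < 1 - q\<^sup>2 * (q\<^sup>2) ^ n"
      using qpoch_square_pos[of n] qpoch_square_pos[of "Suc n"] by (simp add: zero_less_mult_iff)
    ultimately have "?t n = q ^ (n * (n + 1)) * (1 - q\<^sup>2 * (q\<^sup>2) ^ n) / ?P (Suc n)"
      by simp
    moreover have "q ^ (Suc n * (Suc n + 1)) = q ^ (n * (n + 1)) * (q\<^sup>2 * (q\<^sup>2) ^ n)"
      by (simp only: power_add[symmetric] power_mult[symmetric])
         (rule arg_cong[where f = "power q"], simp add: algebra_simps)
    ultimately show ?thesis
      by (simp add: add_divide_distrib[symmetric] algebra_simps)
  qed
  moreover have "(\<lambda>n. ?t (Suc n) + ?t n) sums (qser q (-1) 0 1 - ?t 0 + qser q (-1) 0 1)"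
    by (rule sums_add[OF _ t]) (use t in \<open>subst sums_Suc_iff, simp\<close>)
  ultimately have "?h sums (2 * qser q (-1) 0 1)"
    using sums_Suc_iff[of ?h] by simp
  then show ?thesis
    unfolding c using qpoch_square_pos q
    by (intro sums_nonneg_imp_has_sum) (auto simp: less_imp_le)
qed

text \<open>Pairs \<open>(a, b)\<close> are parametrized by the difference \<open>k = a - b\<close> and the minimum \<open>m\<close>;
  for fixed \<open>k\<close> the sum over \<open>m\<close> is a Durfee-square series.\<close>

lemma theta_has_sum_aux:
  assumes "c \<le> 1"
  shows "((\<lambda>k. q powi (k * (k + int c)) * qser (q\<^sup>2) 1 0 0) has_sum
    ((real c + 1) * (qser q (-1) 0 c)\<^sup>2)) UNIV"
proof -
  let ?P = "qpoch (q\<^sup>2) (q\<^sup>2)"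
  let ?F = "\<lambda>(a, b). q ^ (a * (a + c)) / ?P a * (q ^ (b * (b - c)) / ?P b)"
  let ?g = "\<lambda>(k, m). (m + nat k, m + nat (- k))"
  have bij: "bij_betw ?g (UNIV \<times> UNIV) (UNIV \<times> UNIV)"
    by (rule bij_betwI[where g = "\<lambda>(a, b). (int a - int b, min a b)"]) auto
  have F_g: "?F (?g (k, m)) =
      q powi (k * (k + int c)) * qser_term (q\<^sup>2) 1 (nat \<bar>k\<bar>) (nat \<bar>k\<bar>) m" for k m
  proof -
    define a b where "a = m + nat k" and "b = m + nat (- k)"
    have "int (b * (b - c)) = int b * (int b - int c)"
      using assms by (cases "b = 0") (auto simp: of_nat_diff)
    \<comment> \<open>This is a^2 + b^2 = (a - b)^2 + 2ab with a - b = k and ab = m (m +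
      |k|).\<close>
    then have "int (a * (a + c) + b * (b - c)) = k * (k + int c) + int (2 * (m * (m + nat \<bar>k\<bar>)))"
      by (cases "k \<ge> 0") (simp_all add: a_def b_def algebra_simps)
    then have "q powi int (a * (a + c) + b * (b - c)) =
        q powi (k * (k + int c)) * q powi int (2 * (m * (m + nat \<bar>k\<bar>)))"
      using q by (simp only: power_int_add[OF disjI1[OF less_imp_neq[OF q(1), symmetric]]])
    then have pw: "q ^ (a * (a + c)) * q ^ (b * (b - c)) =
        q powi (k * (k + int c)) * (q\<^sup>2) ^ (m * (m + nat \<bar>k\<bar>))"
      by (simp only: power_int_of_nat power_add power_mult)
    have "?P a * ?P b = ?P m * ?P (m + nat \<bar>k\<bar>)"
      by (cases "k \<ge> 0") (simp_all add: a_def b_def mult.commute)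
    with pw show ?thesis
      by (simp add: a_def[symmetric] b_def[symmetric] qser_term_def)
  qed
  have "(?F has_sum (qser q (-1) 0 c * ((real c + 1) * qser q (-1) 0 c))) (UNIV \<times> UNIV)"
    using q qpoch_square_pos
    by (intro has_sum_times qser_has_sum qser_has_sum_minus assms) (auto simp: less_imp_le)
  then have "((\<lambda>x. ?F (?g x)) has_sum ((real c + 1) * (qser q (-1) 0 c)\<^sup>2)) (UNIV \<times> UNIV)"
    by (subst has_sum_reindex_bij_betw[OF bij]) (simp add: power2_eq_square mult_ac)
  then show ?thesis
  proof (rule has_sum_SigmaD)
    fix k :: int
    \<comment> \<open>The inner sum lies on the diagonal of the \<open>b = 1\<close> lattice at base
      q^2, hence by \<open>qser_diagonal\<close> it is the same for every \<open>k\<close>.\<close>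
    have "(qser_term (q\<^sup>2) 1 (nat \<bar>k\<bar>) (nat \<bar>k\<bar>) has_sum qser (q\<^sup>2) 1 0 0) UNIV"
      using qser_sums[OF q_square, of 1 "nat \<bar>k\<bar>" "nat \<bar>k\<bar>"]
        qser_term_pos[OF q_square, of 1]
      unfolding qser_diagonal[OF q_square, of "nat \<bar>k\<bar>"]
      by (intro sums_nonneg_imp_has_sum) (auto simp: less_imp_le)
    then show "((\<lambda>m. ?F (?g (k, m))) has_sum (q powi (k * (k + int c)) * qser (q\<^sup>2) 1 0 0)) UNIV"
      unfolding F_g by (rule has_sum_cmult_right)
  qed
qed

lemma qser_diagonal_pos: "0 < qser (q\<^sup>2) 1 0 0"
  by (rule qser_pos[OF q_square]) simp

lemma
  assumes "c \<le> 1"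
  shows theta_has_sum: "((\<lambda>k. q powi (k * (k + int c))) has_sum theta q (int c)) UNIV"
    and theta_eq: "theta q (int c) = (real c + 1) * (qser q (-1) 0 c)\<^sup>2 / qser (q\<^sup>2) 1 0 0"
proof -
  let ?D = "qser (q\<^sup>2) 1 0 0"
  have "((\<lambda>k. q powi (k * (k + int c)) * ?D * inverse ?D) has_sum
      ((real c + 1) * (qser q (-1) 0 c)\<^sup>2 * inverse ?D)) UNIV"
    by (rule has_sum_cmult_left[OF theta_has_sum_aux[OF assms]])
  then have *: "((\<lambda>k. q powi (k * (k + int c))) has_sum
      ((real c + 1) * (qser q (-1) 0 c)\<^sup>2 / ?D)) UNIV"
    using qser_diagonal_pos by (simp add: field_simps)
  then show "theta q (int c) = (real c + 1) * (qser q (-1) 0 c)\<^sup>2 / ?D"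
    unfolding theta_def by (rule infsumI)
  with * show "((\<lambda>k. q powi (k * (k + int c))) has_sum theta q (int c)) UNIV" by simp
qed

lemma theta_pos: "0 < theta q 0" "0 < theta q 1"
  using theta_eq[of 0] theta_eq[of 1] qser_diagonal_pos qser_pos[OF q, of "-1" 0 0]
    qser_pos[OF q, of "-1" 0 1] by simp_all

text \<open>The Durfee constant \<open>qser (q\<^sup>2) 1 0 0\<close> cancels; the 2 is
  \<open>real c + 1\<close> at c = 1.\<close>

lemma theta_quotient: "theta q 1 / theta q 0 = 2 * (cf_value q)\<^sup>2"
  using theta_eq[of 0] theta_eq[of 1] qser_diagonal_pos qser_pos[OF q, of "-1" 0 0]
  by (simp add: cf_value_def power_divide)

end

section \<open>Duplication formulas from the parity classes of the square lattice, and the theta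
  modulus\<close>

lemma theta_product_has_sum:
  assumes q: "0 < q" "q < 1" and "c \<le> 1" "d \<le> 1"
  shows "((\<lambda>(x, y). q powi (x * (x + int c) + y * (y + int d))) has_sum
    (theta q (int c) * theta q (int d))) (UNIV \<times> UNIV)"
proof -
  have "((\<lambda>(x, y). q powi (x * (x + int c)) * q powi (y * (y + int d))) has_sum
      (theta q (int c) * theta q (int d))) (UNIV \<times> UNIV)"
    using q by (intro has_sum_times theta_has_sum assms) auto
  moreover have "q powi (x + y) = q powi x * q powi y" for x y
    using q by (simp add: power_int_add)
  ultimately show ?thesis by simp
qed

lemma has_sum_parity_split:
  fixes f :: "int \<times> int \<Rightarrow> real"
  assumes "bij_betw g UNIV {(x, y). even (x + y)}" "bij_betw h UNIV {(x, y). odd (x + y)}"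
    and "((\<lambda>z. f (g z)) has_sum a) UNIV" "((\<lambda>z. f (h z)) has_sum b) UNIV"
  shows "(f has_sum (a + b)) UNIV"
proof -
  have "(f has_sum (a + b)) ({(x, y). even (x + y)} \<union> {(x, y). odd (x + y)})"
    using assms by (intro has_sum_Un_disjoint) (auto simp: has_sum_reindex_bij_betw)
  moreover have "{(x, y). even (x + y)} \<union> {(x, y). odd (x + y)} = (UNIV :: (int \<times> int) set)"
    by auto
  ultimately show ?thesis by simp
qed

lemma bij_betw_even_lattice:
  "bij_betw (\<lambda>(s, t). (s + t, s - t)) UNIV {(x :: int, y). even (x + y)}"
  by (rule bij_betwI[where g = "\<lambda>(x, y). ((x + y) div 2, (x - y) div 2)"]; auto; presburger)

lemma bij_betw_odd_lattice:
  "bij_betw (\<lambda>(s, t). (s + t + 1, s - t)) UNIV {(x :: int, y). odd (x + y)}"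
  by (rule bij_betwI[where g = "\<lambda>(x, y). ((x + y) div 2, (x - y) div 2)"]; auto; presburger)

text \<open>A second parametrization of the odd class: with x = s + t and y = s - t - 1 the form
  x(x+1) + y(y+1) is 2(s^2 + t(t+1)), without a shift of s or an additive constant.\<close>

lemma bij_betw_odd_lattice':
  "bij_betw (\<lambda>(s, t). (s + t, s - t - 1)) UNIV {(x :: int, y). odd (x + y)}"
  by (rule bij_betwI[where g = "\<lambda>(x, y). ((x + y + 1) div 2, (x - y) div 2)"]; auto; presburger)

lemma power_int_square_base: "(q\<^sup>2) powi n = q powi (2 * n)" for q :: real
  by (simp add: power_int_mult)

text \<open>The substitution x = s + t, y = s - t doubles the quadratic form, x^2 + y^2 = 2(s^2 +
  t^2), so the nome becomes q^2. In the first formula the odd class gives 1 + 2(s(s+1) + t(t+1)),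
  hence the factor q; in the second both classes contribute the same product, hence the 2.\<close>

lemma
  assumes q: "0 < q" "q < 1"
  shows theta_0_duplication: "(theta q 0)\<^sup>2 = (theta (q\<^sup>2) 0)\<^sup>2 + q * (theta (q\<^sup>2) 1)\<^sup>2"
    and theta_1_duplication: "(theta q 1)\<^sup>2 = 2 * theta (q\<^sup>2) 0 * theta (q\<^sup>2) 1"
proof -
  note Q = q_square[OF q]
  let ?f = "\<lambda>c (x :: int, y :: int). q powi (x * (x + c) + y * (y + c))"
  let ?g = "\<lambda>c d (x :: int, y :: int). (q\<^sup>2) powi (x * (x + c) + y * (y + d))"
  have g: "(?g (int c) (int d) has_sum (theta (q\<^sup>2) (int c) * theta (q\<^sup>2) (int d))) UNIV"
    if "c \<le> 1" "d \<le> 1" for c d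
    using theta_product_has_sum[OF Q that] by simp
  have g00: "(?g 0 0 has_sum (theta (q\<^sup>2) 0)\<^sup>2) UNIV"
    and g01: "(?g 0 1 has_sum (theta (q\<^sup>2) 0 * theta (q\<^sup>2) 1)) UNIV"
    and g10: "(?g 1 0 has_sum (theta (q\<^sup>2) 0 * theta (q\<^sup>2) 1)) UNIV"
    and g11: "(?g 1 1 has_sum (theta (q\<^sup>2) 1)\<^sup>2) UNIV"
    using g[of 0 0] g[of 0 1] g[of 1 0] g[of 1 1] by (simp_all add: power2_eq_square mult.commute)

  have "(?f 0 has_sum ((theta (q\<^sup>2) 0)\<^sup>2 + q * (theta (q\<^sup>2) 1)\<^sup>2)) UNIV"
  proof (rule has_sum_parity_split[OF bij_betw_even_lattice bij_betw_odd_lattice])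
    have "(\<lambda>z. ?f 0 (case z of (s, t) \<Rightarrow> (s + t, s - t))) = ?g 0 0"
      by (auto simp: power_int_square_base fun_eq_iff intro!: arg_cong[where f = "power_int q"])
         (simp add: algebra_simps)
    with g00 show "((\<lambda>z. ?f 0 (case z of (s, t) \<Rightarrow> (s + t, s - t))) has_sum (theta (q\<^sup>2) 0)\<^sup>2) UNIV"
      by simp
    have "?f 0 (case z of (s, t) \<Rightarrow> (s + t + 1, s - t)) = q * ?g 1 1 z" for z
    proof (cases z)
      case (Pair s t)
      have "(s + t + 1) * (s + t + 1 + 0) + (s - t) * (s - t + 0) =
          1 + 2 * (s * (s + 1) + t * (t + 1))" by (simp add: algebra_simps)
      then show ?thesis using q Pair
        by (simp only: prod.case power_int_square_base) (simp add: power_int_add)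
    qed
    then show "((\<lambda>z. ?f 0 (case z of (s, t) \<Rightarrow> (s + t + 1, s - t))) has_sum
        (q * (theta (q\<^sup>2) 1)\<^sup>2)) UNIV"
      by (simp only:) (rule has_sum_cmult_right[OF g11])
  qed
  moreover have "(?f 0 has_sum (theta q 0)\<^sup>2) UNIV"
    using theta_product_has_sum[OF q, of 0 0] by (simp add: power2_eq_square)
  ultimately show "(theta q 0)\<^sup>2 = (theta (q\<^sup>2) 0)\<^sup>2 + q * (theta (q\<^sup>2) 1)\<^sup>2"
    using has_sum_unique by blast

  have "(?f 1 has_sum (theta (q\<^sup>2) 0 * theta (q\<^sup>2) 1 + theta (q\<^sup>2) 0 * theta (q\<^sup>2) 1)) UNIV"
  proof (rule has_sum_parity_split[OF bij_betw_even_lattice bij_betw_odd_lattice'])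
    have "(\<lambda>z. ?f 1 (case z of (s, t) \<Rightarrow> (s + t, s - t))) = ?g 1 0"
      by (auto simp: power_int_square_base fun_eq_iff intro!: arg_cong[where f = "power_int q"])
         (simp add: algebra_simps)
    with g10 show "((\<lambda>z. ?f 1 (case z of (s, t) \<Rightarrow> (s + t, s - t))) has_sum
        (theta (q\<^sup>2) 0 * theta (q\<^sup>2) 1)) UNIV" by simp
    have "(\<lambda>z. ?f 1 (case z of (s, t) \<Rightarrow> (s + t, s - t - 1))) = ?g 0 1"
      by (auto simp: power_int_square_base fun_eq_iff intro!: arg_cong[where f = "power_int q"])
         (simp add: algebra_simps)
    with g01 show "((\<lambda>z. ?f 1 (case z of (s, t) \<Rightarrow> (s + t, s - t - 1))) has_sum
        (theta (q\<^sup>2) 0 * theta (q\<^sup>2) 1)) UNIV" by simp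
  qed
  moreover have "(?f 1 has_sum (theta q 1)\<^sup>2) UNIV"
    using theta_product_has_sum[OF q, of 1 1] by (simp add: power2_eq_square)
  ultimately show "(theta q 1)\<^sup>2 = 2 * theta (q\<^sup>2) 0 * theta (q\<^sup>2) 1"
    using has_sum_unique by fastforce
qed

text \<open>Written through \<open>cf_value\<close>, so that its fourth root is at once sqrt 2 times
  the limit of the approximants.\<close>

definition theta_modulus :: "real \<Rightarrow> real" where
  "theta_modulus q = 4 * sqrt q * cf_value q ^ 4"

lemma theta_modulus_eq:
  assumes "0 < q" "q < 1"
  shows "theta_modulus q = sqrt q * (theta q 1)\<^sup>2 / (theta q 0)\<^sup>2"
proof -
  have "theta_modulus q = sqrt q * (theta q 1 / theta q 0)\<^sup>2"
    unfolding theta_quotient[OF assms] theta_modulus_def by (simp add: power_mult_distrib)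
  then show ?thesis by (simp add: power_divide)
qed

lemma theta_modulus_pos:
  assumes "0 < q" "q < 1"
  shows "0 < theta_modulus q"
proof -
  have "0 < 1 / (1 + q)" using assms by simp
  with cf_value_bounds(1)[OF assms] have "0 < cf_value q" by linarith
  then show ?thesis using assms by (simp add: theta_modulus_def)
qed

text \<open>This is the quotient of the two duplication formulas. With l = q b^2 / a^2, dividing
  numerator and denominator of 2 sqrt q a b / (a^2 + q b^2) by a^2 gives 2 sqrt l / (1 + l).\<close>

lemma theta_modulus_landen:
  assumes q: "0 < q" "q < 1"
  shows "theta_modulus q = 2 * sqrt (theta_modulus (q\<^sup>2)) / (1 + theta_modulus (q\<^sup>2))"
proof -
  note Q = q_square[OF q]
  define a b where "a = theta (q\<^sup>2) 0" and "b = theta (q\<^sup>2) 1"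
  have pos: "0 < a" "0 < b" using theta_pos[OF Q] by (simp_all add: a_def b_def)
  have k1: "theta_modulus (q\<^sup>2) = q * b\<^sup>2 / a\<^sup>2"
    using theta_modulus_eq[OF Q] q by (simp add: a_def b_def)
  have "sqrt (q * b\<^sup>2 / a\<^sup>2) = sqrt q * b / a"
    using pos by (simp add: real_sqrt_mult real_sqrt_divide)
  moreover have "theta_modulus q = sqrt q * (2 * a * b) / (a\<^sup>2 + q * b\<^sup>2)"
    using theta_modulus_eq[OF q] theta_0_duplication[OF q] theta_1_duplication[OF q]
    by (simp add: a_def b_def)
  moreover have "1 + q * b\<^sup>2 / a\<^sup>2 = (a\<^sup>2 + q * b\<^sup>2) / a\<^sup>2"
    using pos by (simp add: field_simps)
  ultimately show ?thesis
    unfolding k1 using pos by (simp add: power2_eq_square)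
qed

subsection \<open>Gauss's transformation of complete elliptic integrals\<close>

text \<open>Gauss's form of the elliptic integral, homogeneous in (a, b) and adapted to the
  arithmetic-geometric mean; K(x) is the case a = 1, b = sqrt (1 - x^2).\<close>

definition gauss_integrand :: "real \<Rightarrow> real \<Rightarrow> real \<Rightarrow> real" where
  "gauss_integrand a b t = 1 / sqrt (a\<^sup>2 * (cos t)\<^sup>2 + b\<^sup>2 * (sin t)\<^sup>2)"

definition gauss_integral :: "real \<Rightarrow> real \<Rightarrow> real" where
  "gauss_integral a b = integral {0..pi/2} (gauss_integrand a b)"

lemma gauss_radicand_pos:
  fixes a b t :: real
  assumes "0 < a" "0 < b"
  shows "0 < a\<^sup>2 * (cos t)\<^sup>2 + b\<^sup>2 * (sin t)\<^sup>2"
proof (cases "sin t = 0")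
  case True
  show ?thesis unfolding cos_squared_eq True using assms by simp
next
  case False
  with assms have "0 < b\<^sup>2 * (sin t)\<^sup>2"
    by (intro mult_pos_pos) (simp_all only: zero_less_power2, simp_all)
  then show ?thesis by (intro add_nonneg_pos mult_nonneg_nonneg zero_le_power2)
qed

lemma continuous_on_gauss_integrand:
  assumes "0 < a" "0 < b"
  shows "continuous_on S (gauss_integrand a b)"
proof -
  have "sqrt (a\<^sup>2 * (cos t)\<^sup>2 + b\<^sup>2 * (sin t)\<^sup>2) \<noteq> 0" for t
    using real_sqrt_gt_zero[OF gauss_radicand_pos[OF assms, of t]] by linarith
  then show ?thesis
    unfolding gauss_integrand_def[abs_def] by (intro continuous_intros ballI)
qed

lemma gauss_integrable:
  assumes "0 < a" "0 < b"
  shows "gauss_integrand a b integrable_on {u..v}"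
  by (rule integrable_continuous_real[OF continuous_on_gauss_integrand[OF assms]])

lemma gauss_integral_scale:
  assumes "0 < c"
  shows "gauss_integral (c * a) (c * b) = gauss_integral a b / c"
proof -
  have "gauss_integrand (c * a) (c * b) t = inverse c * gauss_integrand a b t" for t
  proof -
    have "(c * a)\<^sup>2 * (cos t)\<^sup>2 + (c * b)\<^sup>2 * (sin t)\<^sup>2 = c\<^sup>2 * (a\<^sup>2 * (cos t)\<^sup>2 + b\<^sup>2 * (sin t)\<^sup>2)"
      by (simp only: power_mult_distrib distrib_left mult.assoc)
    then have "sqrt ((c * a)\<^sup>2 * (cos t)\<^sup>2 + (c * b)\<^sup>2 * (sin t)\<^sup>2) =
        c * sqrt (a\<^sup>2 * (cos t)\<^sup>2 + b\<^sup>2 * (sin t)\<^sup>2)"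
      using assms by (simp only: real_sqrt_mult real_sqrt_abs abs_of_pos)
    then show ?thesis by (simp only: gauss_integrand_def divide_inverse inverse_mult_distrib mult_1)
  qed
  then have "gauss_integrand (c * a) (c * b) = (\<lambda>t. inverse c * gauss_integrand a b t)" by (rule ext)
  then have "gauss_integral (c * a) (c * b) = inverse c * gauss_integral a b"
    by (simp only: gauss_integral_def integral_mult_right)
  then show ?thesis by (simp only: divide_inverse mult.commute)
qed

text \<open>Gauss's substitution \<open>sin \<phi> = 2 a sin \<theta> / ((a + b) + (a - b) sin\<^sup>2 \<theta>)\<close>. As \<open>arcsin\<close> is not
  differentiable at \<open>1\<close>, the point \<open>\<theta> = pi / 2\<close> is treated as exceptional.\<close>

lemma gauss_integral_agm_step:
  assumes ab: "0 < b" "b \<le> a"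
  shows "gauss_integral a b = gauss_integral ((a + b) / 2) (sqrt (a * b))"
proof -
  have a: "0 < a" using ab by simp
  \<comment> \<open>\<open>D\<close> is the denominator of the substitution, \<open>R\<close> the
    new radicand, and \<open>g\<close> the old angle as a function of the new one. \<open>E\<close>
    occurs in the derivative of \<open>y\<close> and again as the root of a perfect square in the
    old radicand.\<close>
  define D where "D t = (a + b) + (a - b) * (sin t)\<^sup>2" for t
  define E where "E t = (a + b) - (a - b) * (sin t)\<^sup>2" for t
  define R where "R t = ((a + b) / 2)\<^sup>2 * (cos t)\<^sup>2 + (sqrt (a * b))\<^sup>2 * (sin t)\<^sup>2" for t
  define y where "y t = 2 * a * sin t / D t" for t
  define g where "g t = arcsin (y t)" for t
  define g' where "g' t = a * E t / (D t * sqrt (R t))" for t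
  have D: "0 < D t" for t using ab by (auto simp: D_def intro!: add_pos_nonneg)
  have E: "0 < E t" for t
  proof -
    have "(a - b) * (sin t)\<^sup>2 \<le> (a - b) * 1"
      using ab by (intro mult_left_mono) (auto simp: power_le_one abs_square_le_1)
    then show ?thesis using ab by (simp add: E_def)
  qed
  have R: "0 < R t" for t
    unfolding R_def using a ab by (intro gauss_radicand_pos) auto
  have cos2: "(cos t)\<^sup>2 = 1 - (sin t)\<^sup>2" for t :: real by (rule cos_squared_eq)
  have R_eq: "4 * R t = (a + b)\<^sup>2 - (a - b)\<^sup>2 * (sin t)\<^sup>2" for t
  proof -
    have "R t = (a + b)\<^sup>2 / 4 * (1 - (sin t)\<^sup>2) + a * b * (sin t)\<^sup>2"
      using a ab by (simp add: R_def cos2 power_divide)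
    then have "4 * R t = (a + b)\<^sup>2 * (1 - (sin t)\<^sup>2) + 4 * (a * b * (sin t)\<^sup>2)" by simp
    then show ?thesis by (simp add: power2_eq_square algebra_simps)
  qed
  have one_minus: "1 - (y t)\<^sup>2 = (2 * cos t * sqrt (R t) / D t)\<^sup>2" for t
  proof -
    \<comment> \<open>This factorization yields both |y| \<le> 1 and the square root in the
      derivative of \<open>arcsin\<close>.\<close>
    have "(D t)\<^sup>2 - (2 * a * sin t)\<^sup>2 = (cos t)\<^sup>2 * (4 * R t)"
      unfolding R_eq cos2 D_def by (simp add: power2_eq_square algebra_simps)
    moreover have "1 - (y t)\<^sup>2 = ((D t)\<^sup>2 - (2 * a * sin t)\<^sup>2) / (D t)\<^sup>2"
      using D[of t] by (simp add: y_def power_divide diff_divide_distrib)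
    ultimately show ?thesis using R[of t]
      by (simp add: power_divide power_mult_distrib)
  qed
  have y0: "0 \<le> y t" if "t \<in> {0..pi/2}" for t
    using that a D[of t] by (auto simp: y_def intro!: divide_nonneg_pos mult_nonneg_nonneg sin_ge_zero)
  have "0 \<le> 1 - (y t)\<^sup>2" for t unfolding one_minus by simp
  then have y1: "\<bar>y t\<bar> \<le> 1" for t by (simp add: abs_square_le_1)
  have "y 0 = 0" "D (pi/2) = 2 * a" by (simp_all add: y_def D_def)
  then have g_ends: "g 0 = 0" "g (pi/2) = pi/2" using a by (simp_all add: g_def y_def)
  have fg: "gauss_integrand a b (g t) = D t / (a * E t)" for t
  proof -
    have s: "sin (g t) = y t" using y1[of t] by (simp add: g_def abs_le_iff)
    \<comment> \<open>\<open>D\<close> and \<open>E\<close> are the sum and the difference of a + b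
      and (a - b) sin^2, so D^2 - E^2 = 4 (a + b)(a - b) sin^2.\<close>
    have "(D t)\<^sup>2 - 4 * (a\<^sup>2 - b\<^sup>2) * (sin t)\<^sup>2 = (E t)\<^sup>2"
      unfolding D_def E_def by (simp add: power2_eq_square algebra_simps)
    moreover have "a\<^sup>2 * (cos (g t))\<^sup>2 + b\<^sup>2 * (sin (g t))\<^sup>2 =
        a\<^sup>2 * ((D t)\<^sup>2 - 4 * (a\<^sup>2 - b\<^sup>2) * (sin t)\<^sup>2) / (D t)\<^sup>2"
    proof -
      have "(y t)\<^sup>2 = 4 * a\<^sup>2 * (sin t)\<^sup>2 / (D t)\<^sup>2"
        by (simp add: y_def power_divide power_mult_distrib)
      moreover have "(D t)\<^sup>2 \<noteq> 0" using D[of t] by simp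
      ultimately show ?thesis unfolding cos2[of "g t"] s by (simp add: field_simps)
    qed
    ultimately have "a\<^sup>2 * (cos (g t))\<^sup>2 + b\<^sup>2 * (sin (g t))\<^sup>2 = (a * E t / D t)\<^sup>2"
      by (simp add: power_divide power_mult_distrib)
    then show ?thesis
      using a D[of t] E[of t] by (simp add: gauss_integrand_def real_sqrt_mult real_sqrt_divide)
  qed
  have "((\<lambda>t. g' t *\<^sub>R gauss_integrand a b (g t)) has_integral
      integral {g 0..g (pi/2)} (gauss_integrand a b)) {0..pi/2}"
  proof (rule has_integral_substitution_strong[where s = "{pi/2}" and c = 0 and d = "pi/2"])
    show "g ` {0..pi/2} \<subseteq> {0..pi/2}"
    proof safe
      fix t assume t: "t \<in> {0..pi/2}"
      have "arcsin 0 \<le> arcsin (y t)"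
        using y0[OF t] y1[of t] by (intro arcsin_le_arcsin) auto
      moreover have "arcsin (y t) \<le> pi / 2" using y1[of t] by (intro arcsin_ubound) auto
      ultimately show "g t \<in> {0..pi/2}" by (simp add: g_def)
    qed
    show "g 0 \<le> g (pi/2)" by (simp add: g_ends)
    have "continuous_on {0..pi/2} D" unfolding D_def[abs_def] by (intro continuous_intros)
    moreover have "D t \<noteq> 0" for t using D[of t] by simp
    ultimately have "continuous_on {0..pi/2} y"
      unfolding y_def[abs_def] by (intro continuous_intros) auto
    moreover have "- 1 \<le> y t \<and> y t \<le> 1" for t using y1[of t] by linarith
    ultimately show "continuous_on {0..pi/2} g"
      unfolding g_def[abs_def] by (intro continuous_on_arcsin) auto
    show "(g has_field_derivative g' t) (at t within {0..pi/2})" if t: "t \<in> {0..pi/2} - {pi/2}" for t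
    proof -
      have c: "0 < cos t" using t by (intro cos_gt_zero_pi) auto
      define w where "w = 2 * cos t * sqrt (R t) / D t"
      have w: "0 < w" "1 - (y t)\<^sup>2 = w\<^sup>2"
        using c R[of t] D[of t] one_minus[of t] by (auto simp: w_def)
      then have "\<bar>y t\<bar> < 1"
        using abs_square_less_1[of "y t"] zero_less_power[OF w(1), of 2] by linarith
      then have y: "- 1 < y t" "y t < 1" by linarith+
      have "(y has_field_derivative 2 * a * cos t * E t / (D t)\<^sup>2) (at t)"
        unfolding y_def[abs_def] D_def[abs_def]
        using D[of t]
        by (auto intro!: derivative_eq_intros simp: D_def E_def power2_eq_square algebra_simps)
      then have "(g has_field_derivative inverse (sqrt (1 - (y t)\<^sup>2)) * (2 * a * cos t * E t / (D t)\<^sup>2)) (at t)"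
        unfolding g_def[abs_def] by (rule DERIV_chain2[where f = arcsin and g = y, OF DERIV_arcsin[OF y]])
      moreover have "inverse (sqrt (1 - (y t)\<^sup>2)) * (2 * a * cos t * E t / (D t)\<^sup>2) = g' t"
      proof -
        have "sqrt (1 - (y t)\<^sup>2) = w" unfolding w(2) using w(1) by simp
        then have "inverse (sqrt (1 - (y t)\<^sup>2)) = D t / (2 * cos t * sqrt (R t))"
          by (simp add: w_def)
        then show ?thesis
          using c D[of t] R[of t] by (simp add: g'_def power2_eq_square)
      qed
      ultimately show ?thesis by (simp add: has_field_derivative_at_within)
    qed
  qed (use a ab continuous_on_gauss_integrand in auto)
  moreover note g_ends
  \<comment> \<open>The factors \<open>D t\<close> and \<open>a * E t\<close> cancel, leaving
    \<open>1 / sqrt (R t)\<close>.\<close>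
  moreover have "g' t *\<^sub>R gauss_integrand a b (g t) = gauss_integrand ((a + b) / 2) (sqrt (a * b)) t" for t
  proof -
    have "gauss_integrand ((a + b) / 2) (sqrt (a * b)) t = 1 / sqrt (R t)"
      by (simp add: gauss_integrand_def R_def)
    then show ?thesis
      unfolding fg using a D[of t] E[of t] by (simp add: g'_def)
  qed
  ultimately have "(gauss_integrand ((a + b) / 2) (sqrt (a * b)) has_integral gauss_integral a b) {0..pi/2}"
    by (simp add: gauss_integral_def)
  then show ?thesis
    by (simp add: gauss_integral_def integral_unique)
qed

section \<open>Complete elliptic integrals and Landen's transformation\<close>

lemma ellK_eq_gauss_integral:
  assumes "0 \<le> x" "x < 1"
  shows "ellK x = gauss_integral 1 (sqrt (1 - x\<^sup>2))"
proof -
  have "1 - x\<^sup>2 * (sin t)\<^sup>2 = 1\<^sup>2 * (cos t)\<^sup>2 + (sqrt (1 - x\<^sup>2))\<^sup>2 * (sin t)\<^sup>2" for t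
    using assms by (simp add: cos_squared_eq algebra_simps abs_square_le_1)
  then show ?thesis
    by (simp add: ellK_def gauss_integral_def gauss_integrand_def[abs_def])
qed

definition period_ratio :: "real \<Rightarrow> real" where
  "period_ratio k = ellK (sqrt (1 - k\<^sup>2)) / ellK k"

lemma complementary_modulus:
  fixes k :: real
  assumes "0 < k" "k < 1"
  shows "0 < sqrt (1 - k\<^sup>2)" "sqrt (1 - k\<^sup>2) < 1" "sqrt (1 - (sqrt (1 - k\<^sup>2))\<^sup>2) = k"
proof -
  have "k\<^sup>2 < 1" using assms by (simp add: abs_square_less_1)
  then show "0 < sqrt (1 - k\<^sup>2)" "sqrt (1 - k\<^sup>2) < 1" "sqrt (1 - (sqrt (1 - k\<^sup>2))\<^sup>2) = k"
    using assms by auto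
qed

lemma ellK_complementary:
  assumes "0 < k" "k < 1"
  shows "ellK (sqrt (1 - k\<^sup>2)) = gauss_integral 1 k"
  using ellK_eq_gauss_integral[of "sqrt (1 - k\<^sup>2)"] complementary_modulus[OF assms] by simp

text \<open>The inequality of arithmetic and geometric means for 1 and l, strict since l <
  1.\<close>

lemma landen_modulus_less_1:
  fixes l :: real
  assumes "0 < l" "l < 1"
  shows "2 * sqrt l / (1 + l) < 1"
proof -
  have "0 < (1 - sqrt l)\<^sup>2" using assms by simp
  then show ?thesis using assms by (simp add: power2_diff divide_simps)
qed

text \<open>Two steps of the arithmetic-geometric mean, with k the transformed modulus: (1 + l, 1 -
  l) goes to (1, sqrt (1 - l^2)) and gives K(k) = (1 + l) K(l); (1, l) goes to ((1 + l)/2, sqrt l)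
  and gives K'(k) = (1 + l)/2 K'(l).\<close>

lemma period_ratio_landen:
  assumes l: "0 < l" "l < 1"
  shows "period_ratio l = 2 * period_ratio (2 * sqrt l / (1 + l))"
proof -
  define k where "k = 2 * sqrt l / (1 + l)"
  have k: "0 < k" "k < 1" using landen_modulus_less_1[OF l] l by (auto simp: k_def)
  have l1: "0 < 1 + l" using l by simp
  have "1 - k\<^sup>2 = ((1 - l) / (1 + l))\<^sup>2"
    using l by (simp add: k_def power_divide power_mult_distrib divide_simps)
      (simp add: power2_eq_square algebra_simps)
  then have k': "sqrt (1 - k\<^sup>2) = (1 - l) / (1 + l)" using l by simp
  have "gauss_integral 1 (sqrt (1 - l\<^sup>2)) = gauss_integral (1 + l) (1 - l)"
    using gauss_integral_agm_step[of "1 - l" "1 + l"] l by (simp add: power2_eq_square algebra_simps)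
  also have "\<dots> = gauss_integral 1 ((1 - l) / (1 + l)) / (1 + l)"
    using gauss_integral_scale[OF l1, of 1 "(1 - l) / (1 + l)"] l1 by simp
  finally have K: "ellK k = (1 + l) * ellK l"
    using ellK_eq_gauss_integral[of k] ellK_eq_gauss_integral[of l] k l l1 by (simp add: k')
  have "gauss_integral 1 l = gauss_integral ((1 + l) / 2) (sqrt l)"
    using gauss_integral_agm_step[of l 1] l by simp
  also have "\<dots> = gauss_integral 1 k / ((1 + l) / 2)"
    using gauss_integral_scale[of "(1 + l) / 2" 1 k] l1 by (simp add: k_def)
  finally have K': "ellK (sqrt (1 - k\<^sup>2)) = (1 + l) / 2 * ellK (sqrt (1 - l\<^sup>2))"
    using l1 by (simp add: ellK_complementary[OF k] ellK_complementary[OF l] field_simps)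
  show ?thesis unfolding k_def[symmetric] period_ratio_def K K' using l1 by simp
qed

subsection \<open>Behaviour of the period ratio\<close>

lemma ellK_0: "ellK 0 = pi / 2"
  by (simp add: ellK_def)

lemma ellK_strict_mono:
  assumes "0 \<le> x" "x < y" "y < 1"
  shows "ellK x < ellK y"
proof -
  have c: "continuous_on {0..pi/2} (\<lambda>t. 1 / sqrt (1 - z\<^sup>2 * (sin t)\<^sup>2))"
    and p: "0 < 1 - z\<^sup>2 * (sin t)\<^sup>2" if "0 \<le> z" "z < 1" for z t :: real
  proof -
    have "z\<^sup>2 * (sin t)\<^sup>2 \<le> z\<^sup>2 * 1" for t
      by (intro mult_left_mono) (auto simp: abs_square_le_1)
    moreover have "z\<^sup>2 < 1" using that by (simp add: abs_square_less_1)
    ultimately have p: "0 < 1 - z\<^sup>2 * (sin t)\<^sup>2" for t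
      by (metis diff_gt_0_iff_gt le_less_trans mult.right_neutral)
    then show "0 < 1 - z\<^sup>2 * (sin t)\<^sup>2" .
    show "continuous_on {0..pi/2} (\<lambda>t. 1 / sqrt (1 - z\<^sup>2 * (sin t)\<^sup>2))"
    proof (intro continuous_intros ballI)
      show "sqrt (1 - z\<^sup>2 * (sin t)\<^sup>2) \<noteq> 0" for t
        using real_sqrt_gt_zero[OF p[of t]] by linarith
    qed
  qed
  show ?thesis unfolding ellK_def
  proof (rule integral_less_real)
    fix t :: real assume "t \<in> {0<..<pi/2}"
    then have "0 < sin t" by (intro sin_gt_zero) auto
    moreover have "x\<^sup>2 < y\<^sup>2" using assms by (intro power_strict_mono) auto
    ultimately have "x\<^sup>2 * (sin t)\<^sup>2 < y\<^sup>2 * (sin t)\<^sup>2" by simp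
    then show "1 / sqrt (1 - x\<^sup>2 * (sin t)\<^sup>2) < 1 / sqrt (1 - y\<^sup>2 * (sin t)\<^sup>2)"
      using p[of x t] p[of y t] assms by (intro divide_strict_left_mono) auto
  next
    show "{0<..<pi/2} \<noteq> {}"
      unfolding greaterThanLessThan_empty_iff using pi_half_gt_zero by linarith
  qed (use c assms in auto)
qed

lemma ellK_pos:
  assumes "0 \<le> k" "k < 1"
  shows "0 < ellK k"
proof (cases "k = 0")
  case False
  then have "pi / 2 < ellK k" using ellK_strict_mono[of 0 k] assms by (simp add: ellK_0)
  then show ?thesis using pi_half_gt_zero by linarith
qed (simp add: ellK_0)

text \<open>K increases and K' decreases with the modulus. This makes the singular modulus
  unique.\<close>

lemma period_ratio_strict_antimono:
  assumes "0 < k" "k < l" "l < 1"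
  shows "period_ratio l < period_ratio k"
proof -
  have k: "0 < k" "k < 1" and l: "0 < l" "l < 1" using assms by auto
  have "k\<^sup>2 < l\<^sup>2" using assms by (intro power_strict_mono) auto
  then have "sqrt (1 - l\<^sup>2) < sqrt (1 - k\<^sup>2)" by simp
  then have "ellK (sqrt (1 - l\<^sup>2)) < ellK (sqrt (1 - k\<^sup>2))"
    using complementary_modulus[OF k] complementary_modulus[OF l] by (intro ellK_strict_mono) auto
  moreover have "ellK k < ellK l" using assms by (intro ellK_strict_mono) auto
  moreover have "0 < ellK k" "0 < ellK (sqrt (1 - l\<^sup>2))"
    using k complementary_modulus[OF l] by (auto intro!: ellK_pos)
  ultimately show ?thesis
    unfolding period_ratio_def by (intro frac_less) auto
qed

text \<open>The factor sin t makes the integral elementary, with cos t as the new variable. The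
  result is compared with K', whose radicand has this form with w^2 = 1 - k^2.\<close>

lemma has_integral_arsinh:
  assumes k: "0 < k" and w: "0 < w"
  shows "((\<lambda>t. sin t / sqrt (w\<^sup>2 * (cos t)\<^sup>2 + k\<^sup>2)) has_integral arsinh (w / k) / w) {0..pi/2}"
proof -
  have "((\<lambda>t. - arsinh (w * cos t / k) / w) has_real_derivative
      sin t / sqrt (w\<^sup>2 * (cos t)\<^sup>2 + k\<^sup>2)) (at t within {0..pi/2})" for t
  proof -
    have "(w * cos t / k)\<^sup>2 + 1 = (w\<^sup>2 * (cos t)\<^sup>2 + k\<^sup>2) / k\<^sup>2"
      using k by (simp add: field_simps)
    then have "sqrt ((w * cos t / k)\<^sup>2 + 1) = sqrt (w\<^sup>2 * (cos t)\<^sup>2 + k\<^sup>2) / k"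
      using k by (simp add: real_sqrt_divide)
    then have eq: "1 / sqrt ((w * cos t / k)\<^sup>2 + 1) * (- w * sin t / k) =
        - w * (sin t / sqrt (w\<^sup>2 * (cos t)\<^sup>2 + k\<^sup>2))"
      using k by simp
    have "((\<lambda>t. w * cos t / k) has_real_derivative - w * sin t / k) (at t within {0..pi/2})"
      using k by (auto intro!: derivative_eq_intros)
    from DERIV_chain2[where f = arsinh, OF arsinh_real_has_field_derivative this]
    have "((\<lambda>t. arsinh (w * cos t / k)) has_real_derivative
        - w * (sin t / sqrt (w\<^sup>2 * (cos t)\<^sup>2 + k\<^sup>2))) (at t within {0..pi/2})"
      unfolding eq .
    from DERIV_cdivide[OF this, of "- w"] show ?thesis using w by simp
  qed
  from fundamental_theorem_of_calculus[OF _ this[unfolded has_real_derivative_iff_has_vector_derivative]]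
  show ?thesis by simp
qed

text \<open>Lower bound: sin t \<le> 1 in the numerator, and the radicand is enlarged to cos^2 +
  k^2, the case w = 1 of the elementary integral. Upper bound: 1 - sin t \<le> |cos t| is at most
  the root of the radicand, so dropping the factor sin t changes the integrand by at most 1 and the
  integral by at most pi/2.\<close>

lemma ellK_complementary_bounds:
  assumes k: "0 < k" "k < 1"
  shows "- ln k \<le> ellK (sqrt (1 - k\<^sup>2))"
    and "ellK (sqrt (1 - k\<^sup>2)) \<le> pi / 2 + ln (2 / k) / sqrt (1 - k\<^sup>2)"
proof -
  define w where "w = sqrt (1 - k\<^sup>2)"
  have w: "0 < w" "w < 1" "w\<^sup>2 = 1 - k\<^sup>2"
    using complementary_modulus[OF k] by (auto simp: w_def)
  have rad: "1\<^sup>2 * (cos t)\<^sup>2 + k\<^sup>2 * (sin t)\<^sup>2 = w\<^sup>2 * (cos t)\<^sup>2 + k\<^sup>2" for t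
    by (simp add: w(3) sin_squared_eq algebra_simps)
  have pos: "0 < w\<^sup>2 * (cos t)\<^sup>2 + k\<^sup>2" for t
    using gauss_radicand_pos[of 1 k t] k by (simp only: rad)
  have int: "(gauss_integrand 1 k has_integral ellK w) {0..pi/2}"
    unfolding w_def ellK_complementary[OF k] gauss_integral_def
    using k by (intro integrable_integral gauss_integrable) auto
  have "arsinh (1 / k) / 1 \<le> ellK w"
  proof (rule has_integral_le[OF has_integral_arsinh[OF k(1)] int])
    fix t assume t: "t \<in> {0..pi/2}"
    have "w\<^sup>2 * (cos t)\<^sup>2 \<le> 1 * (cos t)\<^sup>2" using w k by (intro mult_right_mono) auto
    then show "sin t / sqrt (1\<^sup>2 * (cos t)\<^sup>2 + k\<^sup>2) \<le> gauss_integrand 1 k t"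
      unfolding gauss_integrand_def rad using pos[of t] k t
      by (intro frac_le) (auto intro!: sin_ge_zero add_nonneg_pos)
  qed simp
  moreover have "ln (1 / k) \<le> arsinh (1 / k)"
    using k unfolding arsinh_real_def by (intro ln_mono) (auto intro: add_pos_nonneg)
  moreover have "ln (1 / k) = - ln k" using k by (simp add: ln_div)
  ultimately show "- ln k \<le> ellK (sqrt (1 - k\<^sup>2))" by (simp add: w_def)
  have "ellK w \<le> pi / 2 + arsinh (w / k) / w"
  proof (rule has_integral_le[OF int])
    show "((\<lambda>t. 1 + sin t / sqrt (w\<^sup>2 * (cos t)\<^sup>2 + k\<^sup>2)) has_integral pi / 2 + arsinh (w / k) / w) {0..pi/2}"
      using has_integral_const_real[of "1 :: real" 0 "pi/2"]
      by (intro has_integral_add has_integral_arsinh k w) simp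
    fix t assume t: "t \<in> {0..pi/2}"
    have s: "0 \<le> sin t" "sin t \<le> 1" using t by (auto intro!: sin_ge_zero)
    have "(1 - sin t)\<^sup>2 \<le> 1 - (sin t)\<^sup>2"
      using s mult_left_mono[of "sin t" 1 "sin t"]
      by (simp add: power2_eq_square algebra_simps)
    also have "\<dots> = (cos t)\<^sup>2" by (simp add: cos_squared_eq)
    also have "\<dots> \<le> 1\<^sup>2 * (cos t)\<^sup>2 + k\<^sup>2 * (sin t)\<^sup>2" by simp
    also have "\<dots> = w\<^sup>2 * (cos t)\<^sup>2 + k\<^sup>2" by (rule rad)
    finally have "1 - sin t \<le> sqrt (w\<^sup>2 * (cos t)\<^sup>2 + k\<^sup>2)" by (rule real_le_rsqrt)
    then show "gauss_integrand 1 k t \<le> 1 + sin t / sqrt (w\<^sup>2 * (cos t)\<^sup>2 + k\<^sup>2)"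
      unfolding gauss_integrand_def rad using pos[of t] by (simp add: field_simps)
  qed
  moreover have "arsinh (w / k) \<le> ln (2 / k)"
  proof -
    have "(w / k)\<^sup>2 + 1 = (1 / k)\<^sup>2" using k by (simp add: power_divide w(3) field_simps)
    then have "arsinh (w / k) = ln (w / k + 1 / k)"
      using k by (simp add: arsinh_real_def)
    also have "\<dots> \<le> ln (2 / k)"
      using k w by (intro ln_mono) (auto simp: add_divide_distrib[symmetric] divide_right_mono add_pos_pos)
    finally show ?thesis .
  qed
  ultimately show "ellK (sqrt (1 - k\<^sup>2)) \<le> pi / 2 + ln (2 / k) / sqrt (1 - k\<^sup>2)"
    unfolding w_def[symmetric] using w divide_right_mono[of "arsinh (w / k)" "ln (2 / k)" w] by linarith
qed

text \<open>Together these force K(k) to pi/2 as k tends to 0. The upper bound replaces the radicand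
  by its lower bound 1 - k^2.\<close>

lemma ellK_bounds:
  assumes k: "0 < k" "k < 1"
  shows "pi / 2 \<le> ellK k" "ellK k \<le> pi / 2 / sqrt (1 - k\<^sup>2)"
proof -
  show "pi / 2 \<le> ellK k" using ellK_strict_mono[of 0 k] k by (simp add: ellK_0)
  define w where "w = sqrt (1 - k\<^sup>2)"
  have w: "0 < w" "w < 1" using complementary_modulus[OF k] by (auto simp: w_def)
  have "gauss_integral 1 w \<le> integral {0..pi/2} (\<lambda>t. 1 / w)"
    unfolding gauss_integral_def
  proof (rule integral_le)
    fix t :: real
    have "w\<^sup>2 * (cos t)\<^sup>2 \<le> 1 * (cos t)\<^sup>2"
      using w by (intro mult_right_mono) (auto simp: power_le_one)
    then have "w\<^sup>2 \<le> 1\<^sup>2 * (cos t)\<^sup>2 + w\<^sup>2 * (sin t)\<^sup>2"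
      by (simp add: sin_squared_eq algebra_simps)
    then have "w \<le> sqrt (1\<^sup>2 * (cos t)\<^sup>2 + w\<^sup>2 * (sin t)\<^sup>2)" by (rule real_le_rsqrt)
    then show "gauss_integrand 1 w t \<le> 1 / w"
      unfolding gauss_integrand_def using w by (intro frac_le) auto
  qed (use w gauss_integrable in auto)
  then show "ellK k \<le> pi / 2 / sqrt (1 - k\<^sup>2)"
    using ellK_eq_gauss_integral[of k] k by (simp add: w_def)
qed

text \<open>For small k both sides are -(2/pi) ln k up to lower-order terms, which is sharp enough
  after division by 2^n along the iterates.\<close>

lemma period_ratio_bounds:
  assumes k: "0 < k" "k < 1"
  shows "- ln k * sqrt (1 - k\<^sup>2) / (pi / 2) \<le> period_ratio k"
    and "period_ratio k \<le> (pi / 2 + ln (2 / k) / sqrt (1 - k\<^sup>2)) / (pi / 2)"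
proof -
  note b = ellK_bounds[OF k] ellK_complementary_bounds[OF k]
  have p: "0 < ellK k" "0 < pi / 2" using k by (auto intro!: ellK_pos)
  have w: "0 < sqrt (1 - k\<^sup>2)" by (rule complementary_modulus[OF k])
  have ln: "0 \<le> - ln k" using k by simp
  have "- ln k * sqrt (1 - k\<^sup>2) / (pi / 2) = - ln k / (pi / 2 / sqrt (1 - k\<^sup>2))" by simp
  also have "\<dots> \<le> period_ratio k"
    unfolding period_ratio_def by (rule frac_le) (use b p ln in linarith)+
  finally show "- ln k * sqrt (1 - k\<^sup>2) / (pi / 2) \<le> period_ratio k" .
  show "period_ratio k \<le> (pi / 2 + ln (2 / k) / sqrt (1 - k\<^sup>2)) / (pi / 2)"
    unfolding period_ratio_def by (rule frac_le) (use b p ln in linarith)+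
qed

subsection \<open>Identification of the singular modulus\<close>

lemma theta_modulus_le:
  assumes q: "0 < q" "q < 1"
  shows "theta_modulus q \<le> 4 * sqrt q"
proof -
  have "0 < 1 / (1 + q)" using q by simp
  with cf_value_bounds[OF q] have "cf_value q ^ 4 \<le> 1" by (intro power_le_one) linarith+
  then have "4 * sqrt q * cf_value q ^ 4 \<le> 4 * sqrt q * 1"
    using q by (intro mult_left_mono) auto
  then show ?thesis by (simp add: theta_modulus_def)
qed

context
  fixes q :: real
  assumes q: "0 < q" "q < 1"
begin

lemma iterated_square: "0 < q ^ 2 ^ n" "q ^ 2 ^ n < 1"
  using q by (simp_all add: power_less_one_iff)

lemma iterated_square_Suc: "(q ^ 2 ^ n)\<^sup>2 = q ^ 2 ^ Suc n"
  by (simp add: power_mult[symmetric] mult.commute)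

lemma iterated_square_tendsto: "(\<lambda>n. q ^ 2 ^ n) \<longlonglongrightarrow> 0"
proof -
  have "strict_mono (\<lambda>n. 2 ^ n :: nat)" by (simp add: strict_mono_Suc_iff)
  from LIMSEQ_subseq_LIMSEQ[OF LIMSEQ_power_zero[of q] this] q show ?thesis
    by (simp add: o_def)
qed

lemma theta_modulus_iterate_tendsto: "(\<lambda>n. theta_modulus (q ^ 2 ^ n)) \<longlonglongrightarrow> 0"
proof (rule tendsto_sandwich[where f = "\<lambda>_. 0" and h = "\<lambda>n. 4 * sqrt (q ^ 2 ^ n)"])
  have "(\<lambda>n. 4 * sqrt (q ^ 2 ^ n)) \<longlonglongrightarrow> 4 * sqrt 0"
    by (intro tendsto_intros iterated_square_tendsto)
  then show "(\<lambda>n. 4 * sqrt (q ^ 2 ^ n)) \<longlonglongrightarrow> 0" by simp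
  show "\<forall>\<^sub>F n in sequentially. theta_modulus (q ^ 2 ^ n) \<le> 4 * sqrt (q ^ 2 ^ n)"
    using theta_modulus_le[OF iterated_square] by simp
  show "\<forall>\<^sub>F n in sequentially. 0 \<le> theta_modulus (q ^ 2 ^ n)"
    using theta_modulus_pos[OF iterated_square] by (simp add: less_imp_le)
qed simp

text \<open>The bound \<open>< 1\<close> is clear for large iterates and propagates backwards along the Landen step.\<close>

lemma theta_modulus_less_1: "theta_modulus (q ^ 2 ^ n) < 1"
proof -
  have descend: "theta_modulus (q ^ 2 ^ m) < 1" if "theta_modulus (q ^ 2 ^ Suc m) < 1" for m
    using theta_modulus_landen[OF iterated_square, of m] that
      landen_modulus_less_1[OF theta_modulus_pos[OF iterated_square] that]
    by (simp only: iterated_square_Suc)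
  have "\<forall>\<^sub>F n in sequentially. theta_modulus (q ^ 2 ^ n) < 1"
    using theta_modulus_iterate_tendsto by (rule order_tendstoD) simp
  then obtain N where N: "\<And>m. m \<ge> N \<Longrightarrow> theta_modulus (q ^ 2 ^ m) < 1"
    by (auto simp: eventually_sequentially)
  show ?thesis
  proof (cases "n \<le> N")
    case True
    then show ?thesis
    proof (induction rule: inc_induct)
      case (step m)
      show ?case by (rule descend) (rule step.IH)
    qed (use N in simp)
  qed (use N in auto)
qed

text \<open>Each squaring of the nome is a descending Landen step, which doubles K'/K.\<close>

lemma period_ratio_iterate:
  "period_ratio (theta_modulus (q ^ 2 ^ n)) = 2 ^ n * period_ratio (theta_modulus q)"
proof (induction n)
  case (Suc n)
  have "period_ratio (theta_modulus (q ^ 2 ^ Suc n)) = 2 * period_ratio (theta_modulus (q ^ 2 ^ n))"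
    using period_ratio_landen[OF theta_modulus_pos[OF iterated_square] theta_modulus_less_1, of "Suc n"]
      theta_modulus_landen[OF iterated_square, of n]
    by (simp only: iterated_square_Suc)
  with Suc show ?case by simp
qed simp

text \<open>In ln 4 + (ln of the nome) / 2 + 4 ln u the middle term is 2^n (ln q) / 2, while the
  others stay bounded because u lies in [1/2, 1].\<close>

lemma ln_theta_modulus_iterate_tendsto:
  "(\<lambda>n. ln (theta_modulus (q ^ 2 ^ n)) / 2 ^ n) \<longlonglongrightarrow> ln q / 2"
proof -
  let ?u = "\<lambda>n. cf_value (q ^ 2 ^ n)"
  have u: "1 / 2 \<le> ?u n" "?u n \<le> 1" for n
  proof -
    have "1 / 2 \<le> 1 / (1 + q ^ 2 ^ n)"
      using iterated_square[of n] by (intro divide_left_mono) auto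
    with cf_value_bounds[OF iterated_square, of n] show "1 / 2 \<le> ?u n" "?u n \<le> 1" by linarith+
  qed
  have eq: "ln (theta_modulus (q ^ 2 ^ n)) / 2 ^ n =
      ln q / 2 + (ln 4 * inverse 2 ^ n + 4 * (ln (?u n) * inverse 2 ^ n))" for n
  proof -
    have "0 < ?u n" using u(1)[of n] by linarith
    then have "ln (theta_modulus (q ^ 2 ^ n)) = ln 4 + ln (q ^ 2 ^ n) / 2 + 4 * ln (?u n)"
      using iterated_square(1)[of n]
      by (simp add: theta_modulus_def ln_mult_pos ln_sqrt ln_realpow)
    moreover have "ln (q ^ 2 ^ n) = 2 ^ n * ln q" using q by (simp add: ln_realpow)
    ultimately show ?thesis
      by (simp add: inverse_eq_divide power_divide add_divide_distrib)
  qed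
  have geom: "(\<lambda>n. inverse 2 ^ n :: real) \<longlonglongrightarrow> 0" by (rule LIMSEQ_power_zero) simp
  have "(\<lambda>n. ln (?u n) * inverse 2 ^ n) \<longlonglongrightarrow> 0"
  proof (rule Lim_null_comparison)
    have "\<bar>ln (?u n)\<bar> \<le> ln 2" for n
    proof -
      have "ln (1 / 2) \<le> ln (?u n)" "ln (?u n) \<le> 0" using u[of n] by simp_all
      then show ?thesis by (simp add: ln_div)
    qed
    then show "\<forall>\<^sub>F n in sequentially. norm (ln (?u n) * inverse 2 ^ n) \<le> ln 2 * inverse 2 ^ n"
      by (auto simp: abs_mult intro!: always_eventually mult_right_mono)
    from tendsto_mult_right_zero[OF geom] show "(\<lambda>n. ln 2 * inverse 2 ^ n :: real) \<longlonglongrightarrow> 0" .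
  qed
  then have "(\<lambda>n. ln q / 2 + (ln 4 * inverse 2 ^ n + 4 * (ln (?u n) * inverse 2 ^ n)))
      \<longlonglongrightarrow> ln q / 2 + (ln 4 * 0 + 4 * 0)"
    by (intro tendsto_intros geom)
  then show ?thesis unfolding eq by simp
qed

text \<open>The quotient \<open>period_ratio (k n) / 2 ^ n\<close> is independent of
  \<open>n\<close>, and the bounds of \<open>period_ratio_bounds\<close> divided by 2^n have the
  common limit -(ln q) / pi.\<close>

lemma period_ratio_theta_modulus: "period_ratio (theta_modulus q) = - ln q / pi"
proof -
  define k where "k n = theta_modulus (q ^ 2 ^ n)" for n
  have k: "0 < k n" "k n < 1" for n
    using theta_modulus_pos[OF iterated_square] theta_modulus_less_1 by (simp_all add: k_def)
  have p: "period_ratio (theta_modulus q) = period_ratio (k n) / 2 ^ n" for n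
    by (simp add: k_def period_ratio_iterate)
  have ln_lim: "(\<lambda>n. ln (k n) / 2 ^ n) \<longlonglongrightarrow> ln q / 2"
    unfolding k_def by (rule ln_theta_modulus_iterate_tendsto)
  have "(\<lambda>n. sqrt (1 - (k n)\<^sup>2)) \<longlonglongrightarrow> sqrt (1 - 0\<^sup>2)"
    unfolding k_def by (intro tendsto_intros theta_modulus_iterate_tendsto)
  then have w_lim: "(\<lambda>n. sqrt (1 - (k n)\<^sup>2)) \<longlonglongrightarrow> 1" by simp
  have geom: "(\<lambda>n. inverse 2 ^ n :: real) \<longlonglongrightarrow> 0" by (rule LIMSEQ_power_zero) simp
  have "(\<lambda>n. - (ln (k n) / 2 ^ n) * sqrt (1 - (k n)\<^sup>2) / (pi / 2)) \<longlonglongrightarrow> - (ln q / 2) * 1 / (pi / 2)"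
    by (intro tendsto_intros ln_lim w_lim) auto
  moreover have "- (ln (k n) / 2 ^ n) * sqrt (1 - (k n)\<^sup>2) / (pi / 2) \<le> period_ratio (theta_modulus q)" for n
  proof -
    have "- (ln (k n) / 2 ^ n) * sqrt (1 - (k n)\<^sup>2) / (pi / 2) =
        - ln (k n) * sqrt (1 - (k n)\<^sup>2) / (pi / 2) / 2 ^ n" by simp
    also have "\<dots> \<le> period_ratio (theta_modulus q)"
      unfolding p[of n] by (intro divide_right_mono period_ratio_bounds(1) k) auto
    finally show ?thesis .
  qed
  ultimately have "- (ln q / 2) * 1 / (pi / 2) \<le> period_ratio (theta_modulus q)"
    by (intro LIMSEQ_le_const2) auto
  moreover have "period_ratio (theta_modulus q) \<le> - (ln q / 2) / (pi / 2)"
  proof (rule LIMSEQ_le_const)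
    have "(\<lambda>n. (pi / 2 * inverse 2 ^ n + (ln 2 * inverse 2 ^ n - ln (k n) / 2 ^ n) / sqrt (1 - (k n)\<^sup>2)) / (pi / 2))
        \<longlonglongrightarrow> (pi / 2 * 0 + (ln 2 * 0 - ln q / 2) / 1) / (pi / 2)"
      by (intro tendsto_intros ln_lim w_lim geom) auto
    then show "(\<lambda>n. (pi / 2 * inverse 2 ^ n + (ln 2 * inverse 2 ^ n - ln (k n) / 2 ^ n) / sqrt (1 - (k n)\<^sup>2)) / (pi / 2))
        \<longlonglongrightarrow> - (ln q / 2) / (pi / 2)" by simp
    have "period_ratio (theta_modulus q) \<le>
        (pi / 2 * inverse 2 ^ n + (ln 2 * inverse 2 ^ n - ln (k n) / 2 ^ n) / sqrt (1 - (k n)\<^sup>2)) / (pi / 2)" for n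
    proof -
      have "period_ratio (theta_modulus q) \<le> (pi / 2 + ln (2 / k n) / sqrt (1 - (k n)\<^sup>2)) / (pi / 2) / 2 ^ n"
        unfolding p[of n] by (intro divide_right_mono period_ratio_bounds(2) k) auto
      also have "ln (2 / k n) = ln 2 - ln (k n)" using k[of n] by (simp add: ln_div)
      also have "(pi / 2 + (ln 2 - ln (k n)) / sqrt (1 - (k n)\<^sup>2)) / (pi / 2) / 2 ^ n =
          (pi / 2 * inverse 2 ^ n + (ln 2 * inverse 2 ^ n - ln (k n) / 2 ^ n) / sqrt (1 - (k n)\<^sup>2)) / (pi / 2)"
        by (simp only: power_inverse divide_inverse[of _ "2 ^ n"] distrib_right[symmetric]
            left_diff_distrib[symmetric] times_divide_eq_left[symmetric])
      finally show ?thesis .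
    qed
    then show "\<exists>N. \<forall>n\<ge>N. period_ratio (theta_modulus q) \<le>
        (pi / 2 * inverse 2 ^ n + (ln 2 * inverse 2 ^ n - ln (k n) / 2 ^ n) / sqrt (1 - (k n)\<^sup>2)) / (pi / 2)"
      by blast
  qed
  ultimately show ?thesis by simp
qed

end

text \<open>At this nome -(ln q) / pi is \<open>sqrt r\<close>, so the theta modulus solves the
  defining equation; strict monotonicity gives the uniqueness that the definite description
  requires.\<close>

lemma singular_modulus_eq_theta_modulus:
  assumes "0 < r"
  shows "singular_modulus r = theta_modulus (exp (- pi * sqrt r))"
proof -
  define q where "q = exp (- pi * sqrt r)"
  have q: "0 < q" "q < 1" using assms by (simp_all add: q_def)
  have k: "0 < theta_modulus q" "theta_modulus q < 1"
    using theta_modulus_pos[OF q] theta_modulus_less_1[OF q, of 0] by simp_all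
  have ratio: "period_ratio (theta_modulus q) = sqrt r"
    using period_ratio_theta_modulus[OF q] by (simp add: q_def)
  show ?thesis
    unfolding singular_modulus_def q_def[symmetric]
  proof (rule the_equality)
    fix l :: real
    assume "0 < l \<and> l < 1 \<and> ellK (sqrt (1 - l\<^sup>2)) / ellK l = sqrt r"
    then show "l = theta_modulus q"
      using period_ratio_strict_antimono[of l "theta_modulus q"]
        period_ratio_strict_antimono[of "theta_modulus q" l] k ratio
      by (cases l "theta_modulus q" rule: linorder_cases) (auto simp: period_ratio_def)
  qed (use k ratio in \<open>simp add: period_ratio_def\<close>)
qed

theorem theorem5p1:
  fixes r q :: real
  assumes "r > 0"
    and "q = exp (- pi * sqrt r)"
  shows "convergent (S_approximant q) \<and> S_cf q = singular_modulus r powr (1/4) / sqrt 2"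
proof -
  have q: "0 < q" "q < 1" using assms by simp_all
  note lim = S_approximant_tendsto[OF q]
  have "0 < 1 / (1 + q)" using q by simp
  with cf_value_bounds(1)[OF q] have u: "0 < cf_value q" by linarith
  \<comment> \<open>The fourth root of 4 sqrt q u^4 is taken factor by factor.\<close>
  have "(4 :: real) powr (1/4) = (2 powr 2) powr (1/4)" by simp
  also have "\<dots> = sqrt 2" by (simp only: powr_powr) (simp add: powr_half_sqrt)
  finally have "(4 :: real) powr (1/4) = sqrt 2" .
  moreover have "sqrt q powr (1/4) = q powr (1/8)"
  proof -
    have "sqrt q = q powr (1/2)" using q by (simp add: powr_half_sqrt)
    then show ?thesis by (simp only: powr_powr) simp
  qed
  moreover have "(cf_value q ^ 4) powr (1/4) = cf_value q"
  proof -
    have "cf_value q ^ 4 = cf_value q powr 4" using u by simp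
    then show ?thesis using u by (simp only: powr_powr) simp
  qed
  ultimately have "singular_modulus r powr (1/4) = sqrt 2 * (q powr (1/8) * cf_value q)"
    using singular_modulus_eq_theta_modulus[OF assms(1)] q u assms(2)
    by (simp add: theta_modulus_def powr_mult)
  then have "S_cf q = singular_modulus r powr (1/4) / sqrt 2"
    unfolding S_cf_def limI[OF lim] by simp
  with lim show ?thesis by (auto simp: convergent_def)
qed

end
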